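(* Let $(\Omega,\Sigma,\mu)$ be a $\sigma$-finite complete measure space and let \[ \Phi(x,t)=t^{p(x)}+a(x)\,t^{r(x)},\qquad x\in\Omega,\ t\ge 0, \] where $a,p,r$ are measurable functions on $\Omega$ with $a(x)\ge0$ a.e. and $1\le p(x)\le r(x)<\infty$ a.e. (i) If $r^+<\infty$, then $\Phi$ satisfies condition $\Delta_2$. (ii) If $p^->1$, then the complementary function $\Phi^*$ satisfies condition $\Delta_2$. (iii) If in addition $p(x)<r(x)$ for a.a. $x\in\Omega_1$, where $\Omega_1=\operatorname{supp} a$, then $\Phi$ satisfies condition $\Delta_2$ if and only if $p^+<\infty$ and $\operatorname{ess\,sup}_{x\in\Omega_1}r(x)<\infty$.
   Context: Here $p^+=\operatorname{ess\,sup}_{x\in\Omega}p(x)$, $p^-=\operatorname{ess\,inf}_{x\in\Omega}p(x)$, $r^+=\operatorname{ess\,sup}_{x\in\Omega}r(x)$, and $\operatorname{supp}a=\{x\in\Omega: a(x)\ne0\}$ (the measure-theoretic support). If $\mu(\Omega_1)=0$, the condition $\operatorname{ess\,sup}_{x\in\Omega_1}r(x)<\infty$ is regarded as satisfied. For $\Phi:\Omega\times[0,\infty)\to[0,\infty]$, the complementary function is $\Phi^*(x,t)=\sup_{s\ge 0}\{st-\Phi(x,s)\}$ for a.a. $x\in\Omega$, $t\ge0$. A function $\Phi:\Omega\times[0,\infty)\to[0,\infty]$ satisfies condition $\Delta_2$ if there exist a constant $K>0$ and a non-negative function $h\in L^1(\Omega)$ such that $\Phi(x,2t)\le K\Phi(x,t)+h(x)$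 for a.a. $x\in\Omega$ and all $t\ge0$. *)

theory Defs
  imports "HOL-Probability.Essential_Supremum"
begin

text \<open>
  A function \<open>\<Phi> : \<Omega> \<times> [0, \<infinity>) \<rightarrow> [0, \<infinity>]\<close> is a term of type \<open>'a \<Rightarrow> real \<Rightarrow> ereal\<close>, of which only the
  values at \<open>x \<in> space M\<close> and \<open>t \<ge> 0\<close> matter. Extended reals (rather than extended nonnegative reals)
  are used because \<open>s * t - \<Phi> x s\<close> is signed. The measurable functions \<open>a\<close>, \<open>p\<close>, \<open>r\<close> are
  real-valued, which accounts for \<open>r x < \<infinity>\<close>.
\<close>

text \<open>Dual to \<^const>\<open>esssup\<close>, which the library provides.\<close>
definition essinf :: "'a measure \<Rightarrow> ('a \<Rightarrow> ereal) \<Rightarrow> ereal" where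
  "essinf M f = Sup {z. AE x in M. z \<le> f x}"

definition supp :: "'a measure \<Rightarrow> ('a \<Rightarrow> real) \<Rightarrow> 'a set" where
  "supp M a = {x \<in> space M. a x \<noteq> 0}"

text \<open>Note \<open>0 powr q = 0\<close>, which is the value of \<open>0\<close> to the power \<open>q\<close> for every exponent \<open>q \<ge> 1\<close>.\<close>
definition double_phase :: "('a \<Rightarrow> real) \<Rightarrow> ('a \<Rightarrow> real) \<Rightarrow> ('a \<Rightarrow> real) \<Rightarrow> 'a \<Rightarrow> real \<Rightarrow> ereal" where
  "double_phase a p r x t = ereal (t powr p x + a x * t powr r x)"

definition complementary :: "('a \<Rightarrow> real \<Rightarrow> ereal) \<Rightarrow> 'a \<Rightarrow> real \<Rightarrow> ereal" where
  "complementary \<Phi> x t = (SUP s\<in>{0..}. ereal (s * t) - \<Phi> x s)"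

definition Delta2 :: "'a measure \<Rightarrow> ('a \<Rightarrow> real \<Rightarrow> ereal) \<Rightarrow> bool" where
  "Delta2 M \<Phi> \<longleftrightarrow>
     (\<exists>K h. 0 < K \<and> integrable M h \<and> (\<forall>x\<in>space M. 0 \<le> h x) \<and>
        (AE x in M. \<forall>t\<ge>0. \<Phi> x (2 * t) \<le> ereal K * \<Phi> x t + ereal (h x)))"

end

theory Submission
  imports Defs "HOL-Real_Asymp.Real_Asymp"
begin

text \<open>
  All three parts are pointwise statements about growth exponents: \<open>\<Phi>(x, \<cdot>)\<close> is a combination of the
  powers \<open>t\<^sup>p\<^sup>(\<^sup>x\<^sup>)\<close> and, where \<open>a(x) \<noteq> 0\<close>, \<open>t\<^sup>r\<^sup>(\<^sup>x\<^sup>)\<close>.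

  If the exponents that occur are bounded above by \<open>C\<close>, then \<open>\<Phi>(x, 2t) \<le> 2\<^sup>C \<Phi>(x, t)\<close>, so \<open>\<Delta>\<^sub>2\<close> holds
  with \<open>h = 0\<close> (\<open>Delta2_double_phaseI\<close>). This gives (i) and one direction of (iii).

  If the exponents are at least \<open>q > 1\<close>, then \<open>l\<^sup>q \<Phi>(x, s) \<le> \<Phi>(x, l s)\<close> for \<open>l \<ge> 1\<close>. Substituting
  \<open>s = l u\<close> in the supremum that defines \<open>\<Phi>\<^sup>*(x, 2t)\<close>, with \<open>l\<close> such that \<open>l\<^sup>q = 2l\<close>, turns each
  member \<open>2st - \<Phi>(x, s)\<close> into at most \<open>2l (ut - \<Phi>(x, u))\<close>; hence \<open>\<Phi>\<^sup>*(x, 2t) \<le> 2l \<Phi>\<^sup>*(x, t)\<close>,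
  which is (ii) (\<open>complementary_double_le\<close>).

  Conversely, let \<open>q\<close> be the largest exponent that occurs at \<open>x\<close>: \<open>r(x)\<close> on the support of \<open>a\<close> and
  \<open>p(x)\<close> off it. As \<open>t \<rightarrow> \<infinity>\<close>, \<open>\<Phi>(x, t)\<close> behaves like a positive multiple of \<open>t\<^sup>q\<close> (this is where
  \<open>p < r\<close> on the support enters), so dividing the \<open>\<Delta>\<^sub>2\<close> inequality by \<open>t\<^sup>q\<close> removes \<open>h(x)\<close> in the
  limit and leaves \<open>2\<^sup>q \<le> K\<close> (\<open>doubling_bounds_exponent\<close>). Thus \<open>q \<le> log\<^sub>2 K\<close> almost everywhere,
  and \<open>p \<le> q\<close> gives both bounds required in (iii).
\<close>

section \<open>Essential bounds\<close>

lemma esssup_less_infinity_iff: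
  fixes f :: "'a \<Rightarrow> real"
  assumes [measurable]: "f \<in> borel_measurable M"
  shows "esssup M (\<lambda>x. ereal (f x)) < \<infinity> \<longleftrightarrow> (\<exists>C. AE x in M. f x \<le> C)"
proof
  assume "esssup M (\<lambda>x. ereal (f x)) < \<infinity>"
  then obtain C :: real where C: "esssup M (\<lambda>x. ereal (f x)) < ereal C"
    using ereal_dense2 by blast
  have "AE x in M. ereal (f x) \<le> esssup M (\<lambda>x. ereal (f x))"
    by (rule esssup_AE)
  then have "AE x in M. f x \<le> C"
  proof eventually_elim
    case (elim x)
    then have "ereal (f x) < ereal C" using C by (rule le_less_trans)
    then show ?case by simp
  qed
  then show "\<exists>C. AE x in M. f x \<le> C" ..
next
  assume "\<exists>C. AE x in M. f x \<le> C"
  then obtain C where "AE x in M. ereal (f x) \<le> ereal C" by auto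
  then have "esssup M (\<lambda>x. ereal (f x)) \<le> ereal C"
    by (intro esssup_I) auto
  then show "esssup M (\<lambda>x. ereal (f x)) < \<infinity>"
    by (metis ereal_infty_less(1) ereal_less_eq(1) PInfty_neq_ereal(1) top.extremum_uniqueI top_ereal_def)
qed

lemma less_essinfE:
  fixes f :: "'a \<Rightarrow> real"
  assumes "ereal c < essinf M (\<lambda>x. ereal (f x))"
  obtains q where "c < q" "AE x in M. q \<le> f x"
proof -
  obtain z where z: "ereal c < z" "AE x in M. z \<le> ereal (f x)"
    using assms unfolding essinf_def less_Sup_iff by auto
  \<comment> \<open>On a null space \<open>z\<close> may be infinite, so a real number is chosen below it.\<close>
  obtain q where q: "ereal c < ereal q" "ereal q < z"
    using ereal_dense2[OF z(1)] by blast
  from z(2) have "AE x in M. q \<le> f x"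
  proof eventually_elim
    case (elim x)
    then have "ereal q < ereal (f x)" using q(2) by (rule less_le_trans[rotated])
    then show ?case by simp
  qed
  with q(1) show thesis by (auto intro: that)
qed

section \<open>Bounded exponents imply doubling\<close>

lemma double_phase_double_le:
  assumes "0 \<le> a x" "p x \<le> C" "a x \<noteq> 0 \<Longrightarrow> r x \<le> C" "0 \<le> t"
  shows "double_phase a p r x (2 * t) \<le> ereal (2 powr C) * double_phase a p r x t"
proof -
  have pow: "(2 * t) powr q \<le> 2 powr C * t powr q" if "q \<le> C" for q
    using that \<open>0 \<le> t\<close> by (simp add: powr_mult mult_right_mono)
  have "a x * (2 * t) powr r x \<le> a x * (2 powr C * t powr r x)"
  proof (cases "a x = 0")
    case False
    then show ?thesis using assms pow by (intro mult_left_mono) auto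
  qed simp
  with pow[OF assms(2)] show ?thesis
    by (simp add: double_phase_def algebra_simps)
qed

lemma Delta2_double_phaseI:
  assumes "AE x in M. 0 \<le> a x" "AE x in M. p x \<le> C" "AE x in M. a x \<noteq> 0 \<longrightarrow> r x \<le> C"
  shows "Delta2 M (double_phase a p r)"
proof -
  have "AE x in M. \<forall>t\<ge>0. double_phase a p r x (2 * t) \<le>
      ereal (2 powr C) * double_phase a p r x t + ereal 0"
    using assms by eventually_elim (auto intro: double_phase_double_le)
  then show ?thesis
    unfolding Delta2_def by (intro exI[of _ "2 powr C"] exI[of _ "\<lambda>_. 0"]) auto
qed

section \<open>Superlinear growth and the complementary function\<close>

lemma double_phase_scale_ge:
  assumes "0 \<le> a x" "q \<le> p x" "q \<le> r x" "1 \<le> l" "0 \<le> s"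
  shows "ereal (l powr q) * double_phase a p r x s \<le> double_phase a p r x (l * s)"
proof -
  have pow: "l powr q * s powr e \<le> (l * s) powr e" if "q \<le> e" for e
    using that assms by (simp add: powr_mult mult_right_mono powr_mono)
  have "a x * (l powr q * s powr r x) \<le> a x * (l * s) powr r x"
    using assms pow by (intro mult_left_mono) auto
  with pow[OF assms(2)] show ?thesis
    by (simp add: double_phase_def algebra_simps)
qed

text \<open>
  The scaling factor \<open>l\<close> solves \<open>l\<^sup>q = 2l\<close>: this is what lets \<open>2l\<close> be factored out of both terms of
  \<open>2 (l u) t - l\<^sup>q \<Phi>(x, u)\<close>. Since \<open>q > 1\<close>, such an \<open>l \<ge> 1\<close> exists.
\<close>
lemma complementary_double_le:
  fixes \<Phi> :: "'a \<Rightarrow> real \<Rightarrow> ereal" and l q t :: real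
  defines "l \<equiv> 2 powr (1 / (q - 1))"
  assumes q: "1 < q"
    and growth: "\<And>s. 0 \<le> s \<Longrightarrow> ereal (l powr q) * \<Phi> x s \<le> \<Phi> x (l * s)"
  shows "complementary \<Phi> x (2 * t) \<le> ereal (2 * l) * complementary \<Phi> x t"
proof -
  have "l > 0" by (simp add: l_def)
  have "l powr q = l powr (q - 1) * l powr 1"
    by (simp only: powr_add[symmetric]) simp
  also have "\<dots> = 2 * l"
    using q \<open>l > 0\<close> by (simp add: l_def powr_powr)
  finally have lq: "l powr q = 2 * l" .
  have "ereal (s * (2 * t)) - \<Phi> x s \<le> ereal (2 * l) * complementary \<Phi> x t" if "0 \<le> s" for s
  proof -
    define u where "u = s / l"
    have u: "0 \<le> u" "s = l * u" using that \<open>l > 0\<close> by (simp_all add: u_def)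
    have "ereal (s * (2 * t)) - \<Phi> x s \<le> ereal (s * (2 * t)) - ereal (2 * l) * \<Phi> x u"
      using growth[OF u(1)] by (intro ereal_minus_mono) (simp_all add: lq u(2))
    also have "\<dots> = ereal (2 * l) * (ereal (u * t) - \<Phi> x u)"
      using \<open>l > 0\<close> by (cases "\<Phi> x u") (simp_all add: u(2) algebra_simps)
    also have "\<dots> \<le> ereal (2 * l) * complementary \<Phi> x t"
      unfolding complementary_def using u(1) \<open>l > 0\<close>
      by (intro ereal_mult_left_mono SUP_upper) auto
    finally show ?thesis .
  qed
  then show ?thesis
    unfolding complementary_def[of \<Phi> x "2 * t"] by (intro SUP_least) auto
qed

lemma Delta2_complementary_double_phaseI:
  assumes "1 < q" "AE x in M. 0 \<le> a x" "AE x in M. q \<le> p x" "AE x in M. q \<le> r x"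
  shows "Delta2 M (complementary (double_phase a p r))"
proof -
  define l :: real where "l = 2 powr (1 / (q - 1))"
  have "1 \<le> l" using \<open>1 < q\<close> by (simp add: l_def ge_one_powr_ge_zero)
  have "AE x in M. \<forall>t\<ge>0. complementary (double_phase a p r) x (2 * t) \<le>
      ereal (2 * l) * complementary (double_phase a p r) x t + ereal 0"
    using assms(2-4)
  proof eventually_elim
    case (elim x)
    then have "ereal (l powr q) * double_phase a p r x s \<le> double_phase a p r x (l * s)"
      if "0 \<le> s" for s
      using \<open>1 \<le> l\<close> that by (intro double_phase_scale_ge)
    then show ?case
      using complementary_double_le[OF \<open>1 < q\<close>, of "double_phase a p r" x] by (simp add: l_def)
  qed
  then show ?thesis
    unfolding Delta2_def using \<open>1 \<le> l\<close>
    by (intro exI[of _ "2 * l"] exI[of _ "\<lambda>_. 0"]) auto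
qed

section \<open>Doubling bounds the leading exponent\<close>

text \<open>
  Both sides of the doubling inequality, divided by \<open>t\<^sup>q\<close>, converge: the left side to \<open>2\<^sup>q d\<close> and
  the right side to \<open>K d\<close>, because \<open>q > 0\<close> makes the additive error \<open>h\<close> disappear.
\<close>
lemma doubling_bounds_exponent:
  fixes f :: "real \<Rightarrow> real"
  assumes lim: "((\<lambda>t. f t / t powr q) \<longlongrightarrow> d) at_top" and "0 < d" "0 < q"
    and doubling: "\<And>t. 0 \<le> t \<Longrightarrow> f (2 * t) \<le> K * f t + h"
  shows "2 powr q \<le> K"
proof -
  have "filterlim (\<lambda>t::real. 2 * t) at_top at_top" by real_asymp
  from filterlim_compose[OF lim this]
  have left: "((\<lambda>t. 2 powr q * (f (2 * t) / (2 * t) powr q)) \<longlongrightarrow> 2 powr q * d) at_top"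
    by (rule tendsto_mult_left)
  have "((\<lambda>t. h / t powr q) \<longlongrightarrow> 0) at_top"
    using \<open>0 < q\<close> by real_asymp
  from tendsto_add[OF tendsto_mult_left[OF lim, of K] this]
  have right: "((\<lambda>t. K * (f t / t powr q) + h / t powr q) \<longlongrightarrow> K * d) at_top" by simp
  have "\<forall>\<^sub>F t in at_top. 2 powr q * (f (2 * t) / (2 * t) powr q) \<le> K * (f t / t powr q) + h / t powr q"
    using eventually_gt_at_top[of "0::real"]
  proof eventually_elim
    case (elim t)
    then have "2 powr q * (f (2 * t) / (2 * t) powr q) = f (2 * t) / t powr q"
      by (simp add: powr_mult)
    also have "\<dots> \<le> (K * f t + h) / t powr q"
      using doubling[of t] elim by (intro divide_right_mono) auto
    finally show ?case by (simp add: add_divide_distrib)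
  qed
  from tendsto_le[OF _ right left this] have "2 powr q * d \<le> K * d" by simp
  with \<open>0 < d\<close> show ?thesis by simp
qed

lemma double_phase_doubling_imp_exponent_le:
  assumes "0 \<le> a x" "1 \<le> p x" "p x \<le> r x" and strict: "a x \<noteq> 0 \<Longrightarrow> p x < r x" and "0 < K"
    and doubling: "\<And>t. 0 \<le> t \<Longrightarrow>
      double_phase a p r x (2 * t) \<le> ereal K * double_phase a p r x t + ereal h"
  shows "p x \<le> log 2 K" "a x \<noteq> 0 \<Longrightarrow> r x \<le> log 2 K"
proof -
  define f where "f t = t powr p x + a x * t powr r x" for t
  have f: "f (2 * t) \<le> K * f t + h" if "0 \<le> t" for t
    using doubling[OF that] by (simp add: double_phase_def f_def)
  have r: "r x \<le> log 2 K" if "a x \<noteq> 0"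
  proof -
    have "((\<lambda>t. t powr (p x - r x) + a x) \<longlongrightarrow> 0 + a x) at_top"
      using strict[OF that] by (intro tendsto_add tendsto_neg_powr filterlim_ident) auto
    moreover have "\<forall>\<^sub>F t in at_top. t powr (p x - r x) + a x = f t / t powr r x"
      using eventually_gt_at_top[of "0::real"]
      by eventually_elim (simp add: f_def add_divide_distrib powr_diff)
    ultimately have "((\<lambda>t. f t / t powr r x) \<longlongrightarrow> a x) at_top"
      using Lim_transform_eventually by fastforce
    then have "2 powr r x \<le> K"
      using assms that f by (intro doubling_bounds_exponent[of f _ "a x" K h]) auto
    then show ?thesis using \<open>0 < K\<close> by (simp add: le_log_iff)
  qed
  then show "a x \<noteq> 0 \<Longrightarrow> r x \<le> log 2 K" .
  show "p x \<le> log 2 K"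
  proof (cases "a x = 0")
    case True
    have "\<forall>\<^sub>F t in at_top. 1 = f t / t powr p x"
      using eventually_gt_at_top[of "0::real"] by eventually_elim (simp add: f_def True)
    then have "((\<lambda>t. f t / t powr p x) \<longlongrightarrow> 1) at_top"
      by (rule Lim_transform_eventually[OF tendsto_const])
    then have "2 powr p x \<le> K"
      using assms f by (intro doubling_bounds_exponent[of f _ 1 K h]) auto
    then show ?thesis using \<open>0 < K\<close> by (simp add: le_log_iff)
  next
    case False
    then show ?thesis using r \<open>p x \<le> r x\<close> by simp
  qed
qed

section \<open>The doubling condition for the double phase function\<close>

theorem theorem1p8:
  fixes M :: "'a measure" and a p r :: "'a \<Rightarrow> real"
  assumes "sigma_finite_measure M"
    and "complete_measure M"
    and "a \<in> borel_measurable M" "p \<in> borel_measurable M" "r \<in> borel_measurable M"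
    and "AE x in M. 0 \<le> a x"
    and "AE x in M. 1 \<le> p x \<and> p x \<le> r x"
  shows
    "(esssup M (\<lambda>x. ereal (r x)) < \<infinity> \<longrightarrow> Delta2 M (double_phase a p r)) \<and>
     (1 < essinf M (\<lambda>x. ereal (p x)) \<longrightarrow> Delta2 M (complementary (double_phase a p r))) \<and>
     ((AE x\<in>supp M a in M. p x < r x) \<longrightarrow>
        (Delta2 M (double_phase a p r) \<longleftrightarrow>
           esssup M (\<lambda>x. ereal (p x)) < \<infinity> \<and>
           esssup (restrict_space M (supp M a)) (\<lambda>x. ereal (r x)) < \<infinity>))"
proof (intro conjI impI)
  note [measurable] = assms(3-5)
  note a_nonneg = assms(6) and exponents = assms(7)
  {
    assume "esssup M (\<lambda>x. ereal (r x)) < \<infinity>"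
    then obtain C where C: "AE x in M. r x \<le> C"
      using esssup_less_infinity_iff[of r M] by auto
    have "AE x in M. p x \<le> C" using C exponents by eventually_elim simp
    with C a_nonneg show "Delta2 M (double_phase a p r)"
      by (intro Delta2_double_phaseI) auto
  }
  {
    assume "1 < essinf M (\<lambda>x. ereal (p x))"
    then obtain q where q: "1 < q" "AE x in M. q \<le> p x"
      using less_essinfE[of 1 M p] by (auto simp: one_ereal_def)
    have "AE x in M. q \<le> r x" using q(2) exponents by eventually_elim simp
    with q a_nonneg show "Delta2 M (complementary (double_phase a p r))"
      by (intro Delta2_complementary_double_phaseI)
  }
  assume strict: "AE x\<in>supp M a in M. p x < r x"
  have supp: "supp M a \<in> sets M" unfolding supp_def by measurable
  have "r \<in> borel_measurable (restrict_space M (supp M a))"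
    by (rule measurable_restrict_space1) fact
  then have r_supp: "esssup (restrict_space M (supp M a)) (\<lambda>x. ereal (r x)) < \<infinity> \<longleftrightarrow>
      (\<exists>C. AE x in M. a x \<noteq> 0 \<longrightarrow> r x \<le> C)"
    by (subst esssup_less_infinity_iff)
      (auto simp: AE_restrict_space_iff supp supp_def intro!: ex_cong1 AE_cong)
  show "Delta2 M (double_phase a p r) \<longleftrightarrow>
      esssup M (\<lambda>x. ereal (p x)) < \<infinity> \<and>
      esssup (restrict_space M (supp M a)) (\<lambda>x. ereal (r x)) < \<infinity>"
    unfolding r_supp esssup_less_infinity_iff[OF assms(4)]
  proof safe
    fix C D
    assume p: "AE x in M. p x \<le> C" and r: "AE x in M. a x \<noteq> 0 \<longrightarrow> r x \<le> D"
    have "AE x in M. p x \<le> max C D" "AE x in M. a x \<noteq> 0 \<longrightarrow> r x \<le> max C D"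
      using p r by (eventually_elim, auto)+
    with a_nonneg show "Delta2 M (double_phase a p r)" by (rule Delta2_double_phaseI)
  next
    assume "Delta2 M (double_phase a p r)"
    then obtain K h where "0 < K" and doubling: "AE x in M. \<forall>t\<ge>0.
        double_phase a p r x (2 * t) \<le> ereal K * double_phase a p r x t + ereal (h x)"
      unfolding Delta2_def by blast
    have "AE x in M. p x \<le> log 2 K \<and> (a x \<noteq> 0 \<longrightarrow> r x \<le> log 2 K)"
      using doubling strict a_nonneg exponents AE_space
    proof eventually_elim
      case (elim x)
      then have "a x \<noteq> 0 \<Longrightarrow> p x < r x" by (simp add: supp_def)
      with elim \<open>0 < K\<close> show ?case
        using double_phase_doubling_imp_exponent_le[of a x p r K "h x"] by auto
    qed
    then show "\<exists>C. AE x in M. p x \<le> C" "\<exists>C. AE x in M. a x \<noteq> 0 \<longrightarrow> r x \<le> C"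
      by auto
  qed
qed

end
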